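(* Let $T$ be a Lyndon word with Lyndon SLP $\mathcal{G}$. For every pattern $P$ of length $m$, the number of partition pairs of $P$ (with respect to $\mathcal{G}$) is $O(\lg m)$.
   Context: A string is a Lyndon word if it is lexicographically strictly smaller than each of its non-empty proper suffixes. The standard factorization of a Lyndon word $w$, $|w|\ge2$, is $(u,v)$ with $w=uv$ and $v$ the longest proper suffix of $w$ that is Lyndon. The Lyndon SLP of a Lyndon word $T$ is the straight-line program (rules $X_i\to a$, $a\in\Sigma$, or $X_i \to X_\ell X_r$ with $\ell,r<i$; $\mathit{val}(X)$ the derived string; start symbol derives $T$) such that every $\mathit{val}(X_i)$ is Lyndon, every rule $X_i\to X_\ell X_r$ satisfies that $(\mathit{val}(X_\ell),\mathit{val}(X_r))$ is the standard factorization of $\mathit{val}(X_i)$, and distinct variables derive distinct strings. A partition pair (at position $i$) of $P[1..m]$ is a pair $(P[1..i],P[i+1..m])$ with $i\in[1..m]$ such that there is a rule $X_j\to X_\ell X_r$ of the Lyndon SLP with $P[1..i]$ a (not necessarily proper) suffix of $\mathit{val}(X_\ell)$ and $P[i+1..m]$ a (not necessarily proper) prefix of $\mathit{val}(X_r)$. *)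

theory Defs
  imports
    "HOL-Library.List_Lexorder"
    "HOL-Library.Sublist"
    "HOL-Library.Landau_Symbols"
begin

text \<open>The order \<open><\<close> on lists is the strict lexicographic order of \<open>HOL-Library.List_Lexorder\<close>
  (a proper prefix is smaller).  Words are non-empty.\<close>

definition lyndon :: "'a::linorder list \<Rightarrow> bool" where
  "lyndon w \<longleftrightarrow> w \<noteq> [] \<and> (\<forall>s. s \<noteq> [] \<and> strict_suffix s w \<longrightarrow> w < s)"

definition standard_factorization ::
    "'a::linorder list \<Rightarrow> 'a list \<Rightarrow> 'a list \<Rightarrow> bool" where
  "standard_factorization w u v \<longleftrightarrow>
     lyndon w \<and> 2 \<le> length w \<and> w = u @ v \<and>
     strict_suffix v w \<and> lyndon v \<and>
     (\<forall>v'. strict_suffix v' w \<and> lyndon v' \<longrightarrow> length v' \<le> length v)"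

datatype 'a rule = Letter 'a | Concat nat nat

text \<open>The variables are the positions of the list \<open>rules G\<close>; variable \<open>i\<close> has the
  right-hand side \<open>rules G ! i\<close>.\<close>

record 'a slp =
  rules :: "'a rule list"
  start :: nat

definition slp :: "'a slp \<Rightarrow> bool" where
  "slp G \<longleftrightarrow> start G < length (rules G) \<and>
     (\<forall>i<length (rules G). \<forall>l r. rules G ! i = Concat l r \<longrightarrow> l < i \<and> r < i)"

text \<open>The guards only ensure termination; the default \<open>[]\<close> is never reached from a
  variable of a grammar satisfying \<open>slp\<close>.\<close>

fun rule_val :: "'a rule list \<Rightarrow> nat \<Rightarrow> 'a list" where
  "rule_val R i =
     (if i < length R then
        (case R ! i of
           Letter a \<Rightarrow> [a]
         | Concat l r \<Rightarrow> if l < i \<and> r < i then rule_val R l @ rule_val R r else [])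
      else [])"

declare rule_val.simps [simp del]

definition val :: "'a slp \<Rightarrow> nat \<Rightarrow> 'a list" where
  "val G i = rule_val (rules G) i"

lemma val_Letter:
  assumes "i < length (rules G)" "rules G ! i = Letter a"
  shows "val G i = [a]"
  using assms by (simp add: val_def rule_val.simps[of _ i])

lemma val_Concat:
  assumes "slp G" "i < length (rules G)" "rules G ! i = Concat l r"
  shows "val G i = val G l @ val G r"
  using assms by (simp add: val_def slp_def rule_val.simps[of _ i])

definition lyndon_slp :: "'a::linorder slp \<Rightarrow> 'a list \<Rightarrow> bool" where
  "lyndon_slp G T \<longleftrightarrow>
     slp G \<and> val G (start G) = T \<and>
     (\<forall>i<length (rules G). lyndon (val G i)) \<and>
     (\<forall>i<length (rules G). \<forall>l r. rules G ! i = Concat l r \<longrightarrow>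
        standard_factorization (val G i) (val G l) (val G r)) \<and>
     inj_on (val G) {..<length (rules G)}"

definition partition_pairs :: "'a slp \<Rightarrow> 'a list \<Rightarrow> ('a list \<times> 'a list) set" where
  "partition_pairs G P =
     {(take i P, drop i P) | i. i \<in> {1..length P} \<and>
        (\<exists>j<length (rules G). \<exists>l r. rules G ! j = Concat l r \<and>
           suffix (take i P) (val G l) \<and> prefix (drop i P) (val G r))}"

lemma finite_partition_pairs: "finite (partition_pairs G P)"
proof -
  have "partition_pairs G P \<subseteq> (\<lambda>i. (take i P, drop i P)) ` {1..length P}"
    by (auto simp: partition_pairs_def)
  then show ?thesis
    by (rule finite_subset) simp
qed

end

theory Submission
  imports Defs "HOL-Library.Discrete_Functions"
begin

text \<open>
  The right factor \<open>v\<close> of the standard factorization of \<open>w\<close> is the least non-empty proper suffix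
  of \<open>w\<close>. Hence, if \<open>(x, y)\<close> is a partition pair of \<open>P\<close> with \<open>y\<close> non-empty and \<open>v = y z\<close>, then
  \<open>y z\<close> is least among all \<open>s z\<close>, where \<open>s\<close> ranges over the non-empty proper suffixes of \<open>P\<close>:
  \<open>y\<close> is a \<^emph>\<open>significant\<close> suffix of \<open>tl P\<close>. Of two significant suffixes, the shorter is a border
  of the longer and at most half as long: otherwise they are \<open>a y\<close> and \<open>a a y\<close> with \<open>y\<close>
  non-empty, and \<open>a y z < y z\<close> is equivalent to \<open>a a y z < a y z\<close>, so \<open>a y z\<close> is never least.
  Thus distinct significant suffixes have lengths with distinct integer binary logarithms.
\<close>

lemma append_le_append_cancel [simp]:
  fixes x y :: "'a::order list"
  shows "a @ x \<le> a @ y \<longleftrightarrow> x \<le> y"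
  by (induction a) auto

lemma prefix_if_append_le_append:
  fixes x y :: "'a::order list"
  assumes "x @ s \<le> y @ s" "y @ t \<le> x @ t" "length x \<le> length y"
  shows "prefix x y"
  using assms
proof (induction x arbitrary: y)
  case Nil
  then show ?case by simp
next
  case (Cons c x)
  then obtain d y' where "y = d # y'"
    by (cases y) auto
  with Cons show ?case by auto
qed

lemma finite_Collect_suffix: "finite {s. suffix s w}"
  by (simp flip: set_suffixes_eq)

lemma strict_suffix_if_suffix_tl:
  assumes "suffix s (tl w)" "w \<noteq> []"
  shows "strict_suffix s w"
  using assms suffix_order.le_less_trans strict_suffix_tl by blast

lemma lyndon_iff_le_suffixes:
  "lyndon w \<longleftrightarrow> w \<noteq> [] \<and> (\<forall>s. suffix s w \<longrightarrow> s \<noteq> [] \<longrightarrow> w \<le> s)"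
  unfolding lyndon_def strict_suffix_def by (metis order.order_iff_strict)

lemma standard_factorization_right_le:
  assumes sf: "standard_factorization w u v"
    and s: "strict_suffix s w" "s \<noteq> []"
  shows "v \<le> s"
proof -
  define S where "S = {t. strict_suffix t w \<and> t \<noteq> []}"
  have "finite S"
    by (rule finite_subset[OF _ finite_Collect_suffix[of w]]) (auto simp: S_def strict_suffix_def)
  moreover have "s \<in> S"
    using s by (simp add: S_def)
  ultimately obtain t where "t \<in> S" and least: "\<And>r. r \<in> S \<Longrightarrow> t \<le> r"
    by (metis Min_in Min_le empty_iff)
  then have t: "strict_suffix t w" "t \<noteq> []"
    by (auto simp: S_def)
  then have "lyndon t"
    using least suffix_order.le_less_trans by (auto simp: lyndon_iff_le_suffixes S_def)
  then have "length t \<le> length v"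
    using sf t by (simp add: standard_factorization_def)
  moreover have "suffix t w" "suffix v w"
    using sf t by (auto simp: standard_factorization_def)
  ultimately have "suffix t v"
    using suffix_length_suffix by blast
  then have "v \<le> t"
    using sf t by (simp add: standard_factorization_def lyndon_iff_le_suffixes)
  also have "t \<le> s"
    using least \<open>s \<in> S\<close> .
  finally show ?thesis .
qed

definition significant_suffixes :: "'a::order list \<Rightarrow> 'a list set" where
  "significant_suffixes Q =
     {y. suffix y Q \<and> y \<noteq> [] \<and> (\<exists>z. \<forall>s. suffix s Q \<longrightarrow> s \<noteq> [] \<longrightarrow> y @ z \<le> s @ z)}"

lemma finite_significant_suffixes: "finite (significant_suffixes Q)"
  by (rule finite_subset[OF _ finite_Collect_suffix[of Q]]) (auto simp: significant_suffixes_def)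

lemma significant_suffix_border:
  assumes "x \<in> significant_suffixes Q" "y \<in> significant_suffixes Q" "length y \<le> length x"
  shows "prefix y x" "suffix y x"
proof -
  obtain s where x: "suffix x Q" "x \<noteq> []"
    and x_least: "\<And>r. suffix r Q \<Longrightarrow> r \<noteq> [] \<Longrightarrow> x @ s \<le> r @ s"
    using assms(1) unfolding significant_suffixes_def by blast
  obtain t where y: "suffix y Q" "y \<noteq> []"
    and y_least: "\<And>r. suffix r Q \<Longrightarrow> r \<noteq> [] \<Longrightarrow> y @ t \<le> r @ t"
    using assms(2) unfolding significant_suffixes_def by blast
  show "prefix y x"
    using y_least[OF x] x_least[OF y] assms(3) by (rule prefix_if_append_le_append)
  show "suffix y x"
    using y(1) x(1) assms(3) by (rule suffix_length_suffix)
qed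

lemma square_suffix_not_significant:
  assumes square: "suffix (a @ a @ y) Q" and "a \<noteq> []" "y \<noteq> []"
  shows "a @ y \<notin> significant_suffixes Q"
proof
  assume "a @ y \<in> significant_suffixes Q"
  then obtain z where least: "\<And>s. suffix s Q \<Longrightarrow> s \<noteq> [] \<Longrightarrow> (a @ y) @ z \<le> s @ z"
    unfolding significant_suffixes_def by blast
  have "suffix y Q"
    using square by (blast dest: suffix_appendD)
  then have "a @ y @ z \<le> y @ z"
    using least \<open>y \<noteq> []\<close> by fastforce
  moreover have "y @ z \<le> a @ y @ z"
    using least[OF square] \<open>a \<noteq> []\<close> by simp
  ultimately have "a @ y @ z = y @ z"
    by (rule order.antisym)
  then show False
    using \<open>a \<noteq> []\<close> by simp
qed

lemma significant_suffix_length_double: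
  assumes x: "x \<in> significant_suffixes Q" and y: "y \<in> significant_suffixes Q"
    and less: "length y < length x"
  shows "2 * length y \<le> length x"
proof (rule ccontr)
  assume "\<not> 2 * length y \<le> length x"
  then have short: "length x < 2 * length y" by simp
  have border: "prefix y x" "suffix y x"
    using significant_suffix_border[OF x y] less by simp_all
  obtain a where x_eq: "x = a @ y"
    using border(2) by (rule suffixE)
  have "prefix a y"
    using border(1) x_eq short prefix_length_prefix[of a x y] by simp
  then obtain y' where y_eq: "y = a @ y'"
    by (rule prefixE)
  have "suffix (a @ a @ y') Q"
    using x x_eq y_eq by (simp add: significant_suffixes_def)
  moreover have "a \<noteq> []" "y' \<noteq> []"
    using x_eq y_eq less short by auto
  ultimately show False
    using square_suffix_not_significant y y_eq by blast
qed

lemma floor_log_less_if_double_le: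
  assumes "0 < a" "2 * a \<le> b"
  shows "floor_log a < floor_log b"
  using floor_log_le_iff[OF assms(2)] assms(1) by simp

lemma floor_log_le_log:
  assumes "0 < n"
  shows "real (floor_log n) \<le> log 2 (real n)"
proof (rule le_log_of_power)
  have "real (2 ^ floor_log n) \<le> real n"
    using floor_log_exp2_le[OF assms] by (rule of_nat_mono)
  then show "2 ^ floor_log n \<le> real n" by simp
qed simp

lemma card_significant_suffixes_le:
  "card (significant_suffixes Q) \<le> Suc (floor_log (length Q))"
proof -
  let ?S = "significant_suffixes Q"
  have less: "floor_log (length y) < floor_log (length x)"
    if "x \<in> ?S" "y \<in> ?S" "length y < length x" for x y
    using significant_suffix_length_double[OF that] that(2)
    by (intro floor_log_less_if_double_le) (auto simp: significant_suffixes_def)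
  have "inj_on (\<lambda>y. floor_log (length y)) ?S"
  proof (rule inj_onI)
    fix x y
    assume xy: "x \<in> ?S" "y \<in> ?S" and "floor_log (length x) = floor_log (length y)"
    then have "length x = length y"
      using less by (metis less_irrefl linorder_neqE_nat)
    then have "prefix x y" "prefix y x"
      by (auto intro: significant_suffix_border(1) xy)
    then show "x = y"
      by (rule prefix_order.antisym)
  qed
  moreover have "(\<lambda>y. floor_log (length y)) ` ?S \<subseteq> {..floor_log (length Q)}"
    by (auto simp: significant_suffixes_def intro!: floor_log_le_iff suffix_length_le)
  ultimately have "card ?S \<le> card {..floor_log (length Q)}"
    by (intro card_inj_on_le) auto
  then show ?thesis by simp
qed

lemma standard_factorization_significant_suffix:
  assumes sf: "standard_factorization w u v"
    and "suffix x u" "prefix y v" "x \<noteq> []" "y \<noteq> []"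
  shows "y \<in> significant_suffixes (tl (x @ y))"
proof -
  obtain z where v_eq: "v = y @ z"
    using \<open>prefix y v\<close> by (rule prefixE)
  have suffix_w: "suffix (x @ y @ z) w"
    using sf \<open>suffix x u\<close> v_eq by (simp add: standard_factorization_def)
  have "y @ z \<le> s @ z" if "suffix s (tl (x @ y))" "s \<noteq> []" for s
  proof -
    have "strict_suffix s (x @ y)"
      using that(1) \<open>x \<noteq> []\<close> by (simp add: strict_suffix_if_suffix_tl)
    then have "strict_suffix (s @ z) (x @ y @ z)"
      by (auto simp: strict_suffix_def suffix_def)
    then have "strict_suffix (s @ z) w"
      using suffix_w by (rule suffix_order.less_le_trans)
    then show ?thesis
      using standard_factorization_right_le[OF sf] that(2) v_eq by simp
  qed
  moreover have "suffix y (tl (x @ y))"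
    using \<open>x \<noteq> []\<close> by (simp add: suffix_appendI)
  ultimately show ?thesis
    using \<open>y \<noteq> []\<close> by (auto simp: significant_suffixes_def)
qed

lemma snd_partition_pairs_subset:
  assumes "lyndon_slp G T"
  shows "snd ` partition_pairs G P \<subseteq> insert [] (significant_suffixes (tl P))"
proof
  fix y
  assume "y \<in> snd ` partition_pairs G P"
  then obtain i j l r where i: "1 \<le> i" "i \<le> length P" and y: "y = drop i P"
    and j: "j < length (rules G)" "rules G ! j = Concat l r"
    and pair: "suffix (take i P) (val G l)" "prefix y (val G r)"
    by (auto simp: partition_pairs_def)
  have "standard_factorization (val G j) (val G l) (val G r)"
    using assms j by (simp add: lyndon_slp_def)
  moreover have "take i P \<noteq> []"
    using i by auto
  ultimately have "y \<in> significant_suffixes (tl (take i P @ y))" if "y \<noteq> []"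
    using standard_factorization_significant_suffix pair that by blast
  then have "y \<in> significant_suffixes (tl P)" if "y \<noteq> []"
    using y that by simp
  then show "y \<in> insert [] (significant_suffixes (tl P))"
    by blast
qed

lemma inj_on_snd_partition_pairs: "inj_on snd (partition_pairs G P)"
proof (rule inj_onI)
  fix p q
  assume "p \<in> partition_pairs G P" "q \<in> partition_pairs G P"
  then have "fst p @ snd p = fst q @ snd q"
    by (auto simp: partition_pairs_def)
  moreover assume "snd p = snd q"
  ultimately show "p = q"
    by (simp add: prod_eq_iff)
qed

lemma card_partition_pairs_le:
  assumes "lyndon_slp G T"
  shows "card (partition_pairs G P) \<le> 2 + floor_log (length P)"
proof -
  let ?S = "significant_suffixes (tl P)"
  have "card (partition_pairs G P) \<le> card (insert [] ?S)"
    using inj_on_snd_partition_pairs snd_partition_pairs_subset[OF assms]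
    by (rule card_inj_on_le) (simp add: finite_significant_suffixes)
  also have "\<dots> \<le> Suc (card ?S)"
    by (rule card_insert_le_m1) simp_all
  also have "\<dots> \<le> 2 + floor_log (length (tl P))"
    using card_significant_suffixes_le[of "tl P"] by simp
  also have "\<dots> \<le> 2 + floor_log (length P)"
    by (simp add: floor_log_le_iff)
  finally show ?thesis .
qed

theorem theorem1:
  "\<exists>f :: nat \<Rightarrow> real. f \<in> O(\<lambda>m. log 2 (real m)) \<and>
     (\<forall>(T :: 'a::linorder list) G P. lyndon T \<longrightarrow> lyndon_slp G T \<longrightarrow>
        real (card (partition_pairs G P)) \<le> f (length P))"
proof (intro exI conjI allI impI)
  show "(\<lambda>m. real (2 + floor_log m)) \<in> O(\<lambda>m. log 2 (real m))"
  proof (rule bigoI[of _ 3], rule eventually_sequentiallyI[of 2])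
    fix m :: nat
    assume "2 \<le> m"
    then have "1 \<le> log 2 (real m)" "real (floor_log m) \<le> log 2 (real m)"
      by (simp_all add: floor_log_le_log)
    then show "norm (real (2 + floor_log m)) \<le> 3 * norm (log 2 (real m))" by simp
  qed
next
  fix T :: "'a list" and G P
  assume "lyndon_slp G T"
  then show "real (card (partition_pairs G P)) \<le> real (2 + floor_log (length P))"
    by (intro of_nat_mono card_partition_pairs_le)
qed

end
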